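(* Let $A\in\mathbb{R}^{m\times m}$ be a bottleneck attention matrix, $A_{ij}=\exp\!\big(-\tfrac{1}{2\sqrt{d_e}}\|\widetilde Q_{i,:}-\widetilde Q_{j,:}\|_2^2\big)$ for some $\widetilde Q\in\mathbb{R}^{m\times d_e}$, and let $A^\dagger$ be its Moore-Penrose inverse. For $\alpha>0$ define $A_0=\alpha A$ and $A_{k+1}=2A_k-A_kAA_k$ for $k\ge 0$. If $\alpha$ is sufficiently small (that is, there is $\alpha_0>0$ depending on $A$ such that the following holds for every $0<\alpha<\alpha_0$), then $A_k$ converges to $A^\dagger$ as $k\to\infty$.
   Context: $\widetilde Q\in\mathbb{R}^{m\times d_e}$ is the matrix of $m$ bottleneck tokens (rows $\widetilde Q_{i,:}\in\mathbb{R}^{d_e}$), with keys equal to queries. The bottleneck attention matrix is the Gaussian kernel Gram matrix of these tokens; it is symmetric positive semi-definite with entries in $[0,1]$ and unit diagonal. *)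

theory Defs
  imports "HOL-Analysis.Analysis"
begin

definition bottleneck_attention :: "real ^ 'd ^ 'm \<Rightarrow> real ^ 'm ^ 'm" where
  "bottleneck_attention Q =
     (\<chi> i j. exp (- (1 / (2 * sqrt (real CARD('d)))) * (norm (Q $ i - Q $ j))\<^sup>2))"

(* The four Penrose equations; over the reals the conjugate transpose is the transpose. *)
definition is_moore_penrose :: "real ^ 'n ^ 'm \<Rightarrow> real ^ 'm ^ 'n \<Rightarrow> bool" where
  "is_moore_penrose A X \<longleftrightarrow>
     A ** X ** A = A \<and> X ** A ** X = X \<and>
     transpose (A ** X) = A ** X \<and> transpose (X ** A) = X ** A"

lemma is_moore_penrose_unique:
  fixes A :: "real ^ 'n ^ 'm"
  assumes X: "is_moore_penrose A X" and Y: "is_moore_penrose A Y"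
  shows "X = Y"
proof -
  have AX: "A ** X = A ** Y"
  proof -
    have "A ** X = transpose (A ** Y ** A ** X)"
      using X Y by (simp add: is_moore_penrose_def)
    also have "\<dots> = transpose (A ** X) ** transpose (A ** Y)"
      by (simp add: matrix_transpose_mul matrix_mul_assoc)
    also have "\<dots> = A ** X ** A ** Y"
      using X Y by (simp add: is_moore_penrose_def matrix_mul_assoc)
    also have "\<dots> = A ** Y"
      using X by (simp add: is_moore_penrose_def)
    finally show ?thesis .
  qed
  have XA: "X ** A = Y ** A"
  proof -
    have "X ** A = transpose (X ** (A ** Y ** A))"
      using X Y by (simp add: is_moore_penrose_def)
    also have "\<dots> = transpose (Y ** A) ** transpose (X ** A)"
      by (simp add: matrix_transpose_mul matrix_mul_assoc)
    also have "\<dots> = Y ** A ** (X ** A)"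
      using X Y by (simp add: is_moore_penrose_def)
    also have "\<dots> = Y ** (A ** X ** A)"
      by (simp add: matrix_mul_assoc)
    also have "\<dots> = Y ** A"
      using X by (simp add: is_moore_penrose_def)
    finally show ?thesis .
  qed
  have "X = X ** A ** X" using X by (simp add: is_moore_penrose_def)
  also have "\<dots> = Y ** (A ** X)" by (simp add: XA matrix_mul_assoc)
  also have "\<dots> = Y ** A ** Y" by (simp add: AX matrix_mul_assoc)
  also have "\<dots> = Y" using Y by (simp add: is_moore_penrose_def)
  finally show ?thesis .
qed

(* Every real matrix has a Moore-Penrose inverse, and by is_moore_penrose_unique only one,
   so the description below denotes it. *)
definition moore_penrose :: "real ^ 'n ^ 'm \<Rightarrow> real ^ 'm ^ 'n" where
  "moore_penrose A = (THE X. is_moore_penrose A X)"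

lemma moore_penrose_eqI: "is_moore_penrose A X \<Longrightarrow> moore_penrose A = X"
  unfolding moore_penrose_def by (blast intro: the_equality is_moore_penrose_unique)

primrec newton_iterate :: "real ^ 'm ^ 'm \<Rightarrow> real \<Rightarrow> nat \<Rightarrow> real ^ 'm ^ 'm" where
  "newton_iterate A \<alpha> 0 = \<alpha> *\<^sub>R A"
| "newton_iterate A \<alpha> (Suc k) =
     2 *\<^sub>R newton_iterate A \<alpha> k - newton_iterate A \<alpha> k ** A ** newton_iterate A \<alpha> k"

end

theory Submission
  imports Defs
begin

text \<open>Only the symmetry of \<open>A\<close> matters. Its Moore-Penrose inverse \<open>X\<close> commutes with \<open>A\<close>, so
  \<open>P = X A\<close> is the orthogonal projection onto the range of \<open>A\<close>, and the residual \<open>P - A\<^sub>k A\<close> is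
  squared at each Newton step. The initial residual \<open>P - \<alpha> A\<^sup>2\<close> is a strict contraction for small
  \<open>\<alpha>\<close>, because \<open>A\<close> is bounded below on its range; hence \<open>X - A\<^sub>k = (P - A\<^sub>k A) X\<close> tends to 0.\<close>

lemma matrix_diff_ldistrib: "A ** (B - C) = A ** B - A ** C"
  for A :: "'a::ring_1 ^ 'n ^ 'm"
  by (simp add: matrix_matrix_mult_def vec_eq_iff sum_subtractf right_diff_distrib)

lemma matrix_diff_rdistrib: "(A - B) ** C = A ** C - B ** C"
  for A :: "'a::ring_1 ^ 'n ^ 'm"
  by (simp add: matrix_matrix_mult_def vec_eq_iff sum_subtractf left_diff_distrib)

lemma symmetric_matrix_inner:
  fixes A :: "real ^ 'n ^ 'n"
  assumes "transpose A = A"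
  shows "(A *v x) \<bullet> y = x \<bullet> (A *v y)"
  by (metis assms dot_lmul_matrix vector_transpose_matrix)

text \<open>Symmetry makes \<open>A\<close> injective on its own range: if \<open>x = A *v y\<close>
  and \<open>A *v x = 0\<close>, then \<open>x \<bullet> x = y \<bullet> (A *v x) = 0\<close>.
  \<open>G\<close> is the matrix of a linear left inverse there.\<close>

lemma symmetric_left_factor:
  fixes A :: "real ^ 'n ^ 'n"
  assumes sym: "transpose A = A"
  obtains G where "G ** A ** A = A"
proof -
  let ?S = "range ((*v) A)"
  have span: "span ?S = ?S"
    by (metis linear_subspace_image matrix_vector_mul_linear span_eq_iff subspace_UNIV)
  have "inj_on ((*v) A) (span ?S)"
  proof (subst linear_inj_on_iff_eq_0[OF matrix_vector_mul_linear subspace_span], intro ballI impI)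
    fix x assume "x \<in> span ?S" and 0: "A *v x = 0"
    then obtain y where "x = A *v y"
      using span by auto
    then have "x \<bullet> x = y \<bullet> (A *v x)"
      using symmetric_matrix_inner[OF sym] by blast
    then show "x = 0" using 0 by simp
  qed
  then obtain g where g: "linear g" "\<And>x. x \<in> span ?S \<Longrightarrow> g (A *v x) = x"
    using linear_inj_on_left_inverse[OF matrix_vector_mul_linear] by blast
  have "matrix g *v x = g x" for x
    using g(1) by simp
  then have "matrix g ** A ** A = A"
    unfolding matrix_eq by (simp add: matrix_vector_mul_assoc[symmetric] g(2) span_base)
  then show ?thesis by (rule that)
qed

text \<open>If \<open>G A\<^sup>2 = A\<close>, then \<open>G A = G A\<^sup>2 G\<^sup>T\<close> is symmetric, and \<open>X = G A G\<^sup>T\<close> is the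
  Moore-Penrose inverse of \<open>A\<close>.\<close>

lemma symmetric_moore_penrose_exists:
  fixes A :: "real ^ 'n ^ 'n"
  assumes sym: "transpose A = A"
  obtains X where "is_moore_penrose A X" "A ** X = X ** A"
proof -
  obtain G where G: "G ** A ** A = A"
    using symmetric_left_factor[OF sym] by blast
  define X where "X = G ** A ** transpose G"
  have GT: "A ** A ** transpose G = A"
    using arg_cong[OF G, of transpose] sym by (simp add: matrix_transpose_mul matrix_mul_assoc)
  have GA: "A ** transpose G = G ** A"
    using G GT by (metis matrix_mul_assoc)
  have AGA: "A ** G ** A = A"
    using GA GT by (metis matrix_mul_assoc)
  have symX: "transpose X = X"
    by (simp add: X_def matrix_transpose_mul matrix_mul_assoc sym)
  have XA: "X ** A = G ** A"
    unfolding X_def using GA G by (metis matrix_mul_assoc)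
  have symXA: "transpose (X ** A) = X ** A"
    by (simp add: XA matrix_transpose_mul sym GA)
  have AX: "A ** X = X ** A"
    using symXA by (simp add: matrix_transpose_mul sym symX)
  have "A ** X ** A = A"
    using XA AGA by (metis matrix_mul_assoc)
  moreover have "X ** A ** X = X"
    unfolding XA unfolding X_def using AGA by (metis matrix_mul_assoc)
  ultimately show ?thesis
    using that[of X] symXA AX by (simp add: is_moore_penrose_def)
qed

text \<open>Taking the constant at least 1 keeps its inverse square at most 1, which later bounds
  \<alpha> and keeps the contraction factor nonnegative.\<close>

lemma matrix_vector_bound:
  fixes M :: "real ^ 'n ^ 'm"
  obtains K where "K \<ge> 1" "\<And>x. norm (M *v x) \<le> K * norm x"
proof -
  obtain B where B: "\<And>x. norm (M *v x) \<le> B * norm x"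
    using linear_bounded[OF matrix_vector_mul_linear] by blast
  have "norm (M *v x) \<le> max 1 B * norm x" for x
    using B[of x] by (meson max.cobounded2 mult_right_mono norm_ge_zero order_trans)
  then show ?thesis using that[of "max 1 B"] by simp
qed

lemma tendsto_matrix_pointwise:
  fixes B :: "nat \<Rightarrow> real ^ 'n ^ 'm"
  assumes "\<And>v. (\<lambda>k. B k *v v) \<longlonglongrightarrow> M *v v"
  shows "B \<longlonglongrightarrow> M"
proof (intro vec_tendstoI)
  fix i j
  have "(\<lambda>k. (B k *v axis j 1) $ i) \<longlonglongrightarrow> (M *v axis j 1) $ i"
    by (intro tendsto_vec_nth assms)
  then show "(\<lambda>k. B k $ i $ j) \<longlonglongrightarrow> M $ i $ j"
    by (simp add: matrix_vector_mul_component cart_eq_inner_axis[symmetric])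
qed

text \<open>With \<open>p = P v\<close> and \<open>a = A v\<close>, the squared residual is
  \<open>|p|^2 - 2 \<alpha> |a|^2 + \<alpha>^2 |A a|^2\<close>. The upper bound \<open>C\<close> on
  \<open>A\<close> lets one copy of \<open>\<alpha> |a|^2\<close> absorb the last term; the lower
  bound \<open>|p| \<le> K |a|\<close> turns the other copy into a fixed fraction of
  \<open>|p|^2\<close>.\<close>

lemma projection_minus_square_contracts:
  fixes A X :: "real ^ 'n ^ 'n"
  assumes sym: "transpose A = A"
    and mp: "is_moore_penrose A X"
    and C: "C > 0" "\<And>x. norm (A *v x) \<le> C * norm x"
    and \<alpha>: "0 < \<alpha>" "\<alpha> < 1 / C\<^sup>2" "\<alpha> \<le> 1"
  obtains q where "0 \<le> q" "q < 1" "\<And>v. norm ((X ** A - \<alpha> *\<^sub>R (A ** A)) *v v) \<le> q * norm v"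
proof -
  let ?P = "X ** A"
  obtain K where K: "K \<ge> 1" "\<And>x. norm (X *v x) \<le> K * norm x"
    using matrix_vector_bound by blast
  \<comment> \<open>\<open>r\<close> is the factor for squared norms, so the contraction rate is
    \<open>sqrt r\<close>; \<open>r \<ge> 0\<close> follows from
    \<open>\<alpha> \<le> 1 \<le> K\<^sup>2\<close>.\<close>
  define r where "r = 1 - \<alpha> / K\<^sup>2"
  have K2: "K\<^sup>2 \<ge> 1" using K(1) by simp
  have r: "0 \<le> r" "r < 1"
    using \<alpha> K(1) order_trans[OF \<alpha>(3) K2] by (auto simp: r_def)
  have PP: "?P ** ?P = ?P" and symP: "transpose ?P = ?P" and AP: "A ** ?P = A"
    using mp by (simp_all add: is_moore_penrose_def matrix_mul_assoc)
  have "norm ((?P - \<alpha> *\<^sub>R (A ** A)) *v v) \<le> sqrt r * norm v" for v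
  proof -
    let ?p = "?P *v v" and ?a = "A *v v"
    have "?p \<bullet> ?p = v \<bullet> ?p"
      by (simp add: symmetric_matrix_inner[OF symP] matrix_vector_mul_assoc PP)
    then have "norm ?p * norm ?p \<le> norm v * norm ?p"
      by (metis norm_cauchy_schwarz norm_eq_sqrt_inner power2_eq_square power2_norm_eq_inner)
    then have pv: "norm ?p \<le> norm v"
      by (metis mult_le_cancel_right norm_ge_zero norm_le_zero_iff linorder_not_le order_trans)
    \<comment> \<open>Since \<open>?p = X *v ?a\<close>, a bound on \<open>X\<close> is a lower
      bound for \<open>A\<close> on its range.\<close>
    have "norm ?p \<le> K * norm ?a"
      using K(2)[of ?a] by (simp add: matrix_vector_mul_assoc)
    then have pa: "(norm ?p)\<^sup>2 \<le> K\<^sup>2 * (norm ?a)\<^sup>2"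
      by (metis norm_ge_zero power_mono power_mult_distrib)
    have aa: "(norm (A *v ?a))\<^sup>2 \<le> C\<^sup>2 * (norm ?a)\<^sup>2"
      by (metis C(2) norm_ge_zero power_mono power_mult_distrib)
    have "A *v ?p = ?a"
      by (simp add: matrix_vector_mul_assoc AP)
    then have ip: "?p \<bullet> (A *v ?a) = ?a \<bullet> ?a"
      by (metis symmetric_matrix_inner[OF sym])
    have "(norm ((?P - \<alpha> *\<^sub>R (A ** A)) *v v))\<^sup>2 = (norm (?p - \<alpha> *\<^sub>R (A *v ?a)))\<^sup>2"
      by (simp add: matrix_vector_mult_diff_rdistrib scaleR_matrix_vector_assoc[symmetric]
          matrix_vector_mul_assoc)
    also have "\<dots> = (norm ?p)\<^sup>2 - 2 * \<alpha> * (norm ?a)\<^sup>2 + \<alpha>\<^sup>2 * (norm (A *v ?a))\<^sup>2"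
      unfolding power2_norm_eq_inner
      by (simp add: inner_diff_left inner_diff_right inner_commute[of "A *v ?a" ?p] ip
          power2_eq_square algebra_simps)
    also have "\<dots> \<le> (norm ?p)\<^sup>2 - \<alpha> * (norm ?a)\<^sup>2"
    proof -
      have "\<alpha> * C\<^sup>2 \<le> 1" using \<alpha> C(1) by (simp add: field_simps)
      then have "\<alpha> * C\<^sup>2 * (norm ?a)\<^sup>2 \<le> (norm ?a)\<^sup>2"
        by (simp add: mult_left_le_one_le \<alpha> less_imp_le)
      then have "\<alpha> * (norm (A *v ?a))\<^sup>2 \<le> (norm ?a)\<^sup>2"
        using mult_left_mono[OF aa less_imp_le[OF \<alpha>(1)]] by linarith
      then have "\<alpha> * (\<alpha> * (norm (A *v ?a))\<^sup>2) \<le> \<alpha> * (norm ?a)\<^sup>2"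
        using \<alpha> by simp
      then show ?thesis by (simp add: power2_eq_square mult.assoc)
    qed
    also have "\<dots> \<le> r * (norm ?p)\<^sup>2"
    proof -
      have "(norm ?p)\<^sup>2 / K\<^sup>2 \<le> (norm ?a)\<^sup>2"
        using pa K2 by (simp add: divide_le_eq mult.commute)
      from mult_left_mono[OF this, of \<alpha>] show ?thesis
        using \<alpha> by (simp add: r_def algebra_simps)
    qed
    also have "\<dots> \<le> r * (norm v)\<^sup>2"
      using pv r by (intro mult_left_mono power_mono) auto
    finally have "norm ((?P - \<alpha> *\<^sub>R (A ** A)) *v v) \<le> sqrt (r * (norm v)\<^sup>2)"
      by (rule real_le_rsqrt)
    then show ?thesis by (simp add: real_sqrt_mult)
  qed
  then show ?thesis using that[of "sqrt r"] r by simp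
qed

lemma newton_iterate_tendsto:
  fixes A X :: "real ^ 'n ^ 'n"
  assumes mp: "is_moore_penrose A X" and comm: "A ** X = X ** A"
    and q: "0 \<le> q" "q < 1" "\<And>v. norm ((X ** A - \<alpha> *\<^sub>R (A ** A)) *v v) \<le> q * norm v"
  shows "newton_iterate A \<alpha> \<longlonglongrightarrow> X"
proof (rule tendsto_matrix_pointwise)
  fix v
  define P where "P = X ** A"
  let ?N = "newton_iterate A \<alpha>"
  have PA: "P ** A = A" and AP: "A ** P = A" and PP: "P ** P = P" and PX: "P ** X = X"
    using mp comm by (simp_all add: P_def is_moore_penrose_def matrix_mul_assoc)
  \<comment> \<open>The iterates inherit absorption of \<open>P\<close> on both sides from
    \<open>A\<close>, because each term of the recursion begins and ends with an iterate.\<close>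
  have PN: "P ** ?N k = ?N k" for k
    by (induction k)
      (simp_all add: PA matrix_diff_ldistrib matrix_scalar_ac scalar_matrix_assoc[symmetric]
        matrix_mul_assoc)
  have NP: "?N k ** P = ?N k" for k
    by (induction k)
      (simp_all add: AP matrix_diff_rdistrib scalar_matrix_assoc[symmetric]
        matrix_mul_assoc[symmetric])
  \<comment> \<open>Each squaring of the residual doubles the exponent. The vector is arbitrary
    because the induction hypothesis is applied both to \<open>w\<close> and to its image.\<close>
  have bound: "norm ((P - ?N k ** A) *v w) \<le> q ^ 2 ^ k * norm w" for k w
  proof (induction k arbitrary: w)
    case 0
    then show ?case using q(3) by (simp add: P_def scalar_matrix_assoc[symmetric])
  next
    case (Suc k)
    let ?D = "P - ?N k ** A"
    \<comment> \<open>Expanding the square gives \<open>P - 2 N A + N A N A\<close>, where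
      \<open>P N = N\<close> and \<open>A P = A\<close> simplify the cross terms.\<close>
    have "P - ?N (Suc k) ** A = ?D ** ?D"
      using AP by (simp add: matrix_diff_ldistrib matrix_diff_rdistrib PP PN
          matrix_mul_assoc[symmetric] scalar_matrix_assoc[symmetric])
        (simp add: matrix_mul_assoc PN scaleR_2)
    then have "norm ((P - ?N (Suc k) ** A) *v w) = norm (?D *v (?D *v w))"
      by (simp add: matrix_vector_mul_assoc)
    also have "\<dots> \<le> q ^ 2 ^ k * (q ^ 2 ^ k * norm w)"
      by (meson Suc.IH mult_left_mono order_trans q(1) zero_le_power)
    finally show ?case by (simp add: power_add mult_2)
  qed
  have "(\<lambda>k. (P - ?N k ** A) *v (X *v v)) \<longlonglongrightarrow> 0"
  proof (rule Lim_null_comparison)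
    \<comment> \<open>As \<open>k \<le> 2 ^ k\<close> and \<open>q < 1\<close>, a geometric sequence
      dominates.\<close>
    have "q ^ 2 ^ k \<le> q ^ k" for k :: nat
      using q by (intro power_decreasing) (auto simp: less_imp_le)
    then show "\<forall>\<^sub>F k in sequentially. norm ((P - ?N k ** A) *v (X *v v)) \<le> q ^ k * norm (X *v v)"
      by (intro always_eventually allI order_trans[OF bound] mult_right_mono) auto
    show "(\<lambda>k. q ^ k * norm (X *v v)) \<longlonglongrightarrow> 0"
      using q by (intro tendsto_mult_left_zero LIMSEQ_power_zero) auto
  qed
  \<comment> \<open>Multiplying the residual by \<open>X\<close> recovers the error, by
    \<open>P X = X\<close> and \<open>N A X = N P = N\<close>.\<close>
  moreover have "(P - ?N k ** A) *v (X *v v) = X *v v - ?N k *v v" for k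
  proof -
    have "?N k ** A ** X = ?N k"
      using NP[of k] comm by (simp add: P_def matrix_mul_assoc[symmetric])
    then show ?thesis
      by (simp add: matrix_vector_mul_assoc matrix_diff_rdistrib PX matrix_vector_mult_diff_rdistrib)
  qed
  ultimately have "(\<lambda>k. X *v v - (X *v v - ?N k *v v)) \<longlonglongrightarrow> X *v v - 0"
    by (intro tendsto_diff tendsto_const) simp
  then show "(\<lambda>k. ?N k *v v) \<longlonglongrightarrow> X *v v" by simp
qed

theorem proposition1:
  fixes Q :: "real ^ 'd ^ 'm" and A :: "real ^ 'm ^ 'm"
  assumes "A = bottleneck_attention Q"
  shows "\<exists>\<alpha>\<^sub>0>0. \<forall>\<alpha>. 0 < \<alpha> \<and> \<alpha> < \<alpha>\<^sub>0 \<longrightarrow> newton_iterate A \<alpha> \<longlonglongrightarrow> moore_penrose A"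
proof -
  have sym: "transpose A = A"
    by (simp add: assms bottleneck_attention_def transpose_def vec_eq_iff norm_minus_commute)
  obtain X where X: "is_moore_penrose A X" "A ** X = X ** A"
    using symmetric_moore_penrose_exists[OF sym] by blast
  obtain C where C: "C \<ge> 1" "\<And>x. norm (A *v x) \<le> C * norm x"
    using matrix_vector_bound by blast
  \<comment> \<open>The threshold \<open>1 / C\<^sup>2\<close> ensures
    \<open>\<alpha> * C\<^sup>2 < 1\<close>, and also \<open>\<alpha> \<le> 1\<close> because
    \<open>C \<ge> 1\<close>.\<close>
  have "newton_iterate A \<alpha> \<longlonglongrightarrow> moore_penrose A" if \<alpha>: "0 < \<alpha>" "\<alpha> < 1 / C\<^sup>2" for \<alpha>
  proof -
    have "1 / C\<^sup>2 \<le> 1" using C(1) by simp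
    with \<alpha> have "\<alpha> \<le> 1" by simp
    then obtain q where "0 \<le> q" "q < 1"
      "\<And>v. norm ((X ** A - \<alpha> *\<^sub>R (A ** A)) *v v) \<le> q * norm v"
      using projection_minus_square_contracts[OF sym X(1) _ C(2) \<alpha>] C(1) by auto
    then show ?thesis
      using newton_iterate_tendsto[OF X] moore_penrose_eqI[OF X(1)] by simp
  qed
  then show ?thesis using C(1) by (intro exI[of _ "1 / C\<^sup>2"]) auto
qed

end
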